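(* Let $\mathcal{A}=(a_{i_1i_2\cdots i_m})\in T_{m,n}$ with $R_i(\mathcal{A})>0$ for all $i\in[n]$. Then $\mathcal{A}$ is a $B_\pi^R$-tensor if and only if the nonnegative vector $\pi\in\mathbb{R}^n$ satisfies $0<\sum_{J\in[n]^{m-1}}\pi_J\le1$, and $\pi_J>M_J(\mathcal{A})$ for all $J\in[n]^{m-1}$.
   Context: $m$ and $n$ are positive integers and $[n]=\{1,\dots,n\}$. $T_{m,n}$ is the set of real $m$th-order $n$-dimensional tensors. For $J=(i_2,\dots,i_m)\in[n]^{m-1}$ write $a_{iJ}=a_{ii_2\cdots i_m}$. The $i$th row sum is $R_i(\mathcal{A})=\sum_{J\in[n]^{m-1}}a_{iJ}$. For a nonnegative vector $\pi=(\pi_1,\dots,\pi_n)\in\mathbb{R}^n$, $\pi_J:=\pi_{i_2}\cdots\pi_{i_m}$. A tensor $\mathcal{A}\in T_{m,n}$ is a $B_\pi^R$-tensor (the superscript $R$ denotes the row sum vector $R(\mathcal{A})=(R_1(\mathcal{A}),\dots,R_n(\mathcal{A}))$ of $\mathcal{A}$) if the nonnegative vector $\pi$ satisfies $0<\sum_{J\in[n]^{m-1}}\pi_J\le1$ and for all $i\in[n]$: $R_i(\mathcal{A})>0$, and $\pi_JR_i(\mathcal{A})>a_{iJ}$ for all $J\in[n]^{m-1}\setminus\{(i,\dots,i)\}$. For $J\in[n]^{m-1}$, $$M_{iJ}(\mathcal{A})=\frac{a_{iJ}}{R_i(\mathcal{A})}\ \text{ for } i\in[n],\qquad M_J(\mathcal{A})=\max_{i\in[n],\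 (i,\dots,i)\ne J}M_{iJ}(\mathcal{A}).$$ *)

theory Defs
  imports "HOL-Analysis.Analysis"
begin

text \<open>
  The index set [n] is a finite type \<open>'n\<close> with n = \<open>CARD('n)\<close>; vectors in \<open>\<real>\<close>^n have type
  \<open>real ^ 'n\<close>. A tensor of order m is a function on index lists, of which only the values at
  lists of length m matter: the entry \<open>a\<close> with index \<open>i J\<close> is \<open>A (i # J)\<close>, where the list \<open>J\<close>
  has length m - 1. The order is a separate argument \<open>m\<close>, meant to be positive.
\<close>

type_synonym 'n tensor = "'n list \<Rightarrow> real"

definition multi_indices :: "nat \<Rightarrow> 'n::finite list set" where
  "multi_indices k = {J. length J = k}"

definition row_sum :: "nat \<Rightarrow> 'n::finite tensor \<Rightarrow> 'n \<Rightarrow> real" where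
  "row_sum m A i = (\<Sum>J\<in>multi_indices (m - 1). A (i # J))"

definition vec_monom :: "real ^ 'n::finite \<Rightarrow> 'n list \<Rightarrow> real" where
  "vec_monom \<pi> J = (\<Prod>j\<leftarrow>J. \<pi> $ j)"

definition B_pi_R_tensor :: "nat \<Rightarrow> real ^ 'n::finite \<Rightarrow> 'n tensor \<Rightarrow> bool" where
  "B_pi_R_tensor m \<pi> A \<longleftrightarrow>
     (\<forall>i. 0 \<le> \<pi> $ i) \<and>
     0 < (\<Sum>J\<in>multi_indices (m - 1). vec_monom \<pi> J) \<and>
     (\<Sum>J\<in>multi_indices (m - 1). vec_monom \<pi> J) \<le> 1 \<and>
     (\<forall>i. row_sum m A i > 0 \<and>
          (\<forall>J\<in>multi_indices (m - 1) - {replicate (m - 1) i}.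
             vec_monom \<pi> J * row_sum m A i > A (i # J)))"

definition M_entry :: "nat \<Rightarrow> 'n::finite tensor \<Rightarrow> 'n \<Rightarrow> 'n list \<Rightarrow> real" where
  "M_entry m A i J = A (i # J) / row_sum m A i"

text \<open>
  The maximum ranges over the \<open>i\<close> with (i,...,i) \<open>\<noteq> J\<close>. No such \<open>i\<close> exists when n = 1 or
  m = 1; the maximum of the empty set is taken to be \<open>-\<infinity>\<close>, hence the type \<^typ>\<open>ereal\<close>.
\<close>

definition M_max :: "nat \<Rightarrow> 'n::finite tensor \<Rightarrow> 'n list \<Rightarrow> ereal" where
  "M_max m A J =
     (let I = {i. replicate (m - 1) i \<noteq> J}
      in if I = {} then -\<infinity> else ereal (Max ((\<lambda>i. M_entry m A i J) ` I)))"

end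

theory Submission imports Defs begin

text \<open>
  Since every row sum is positive, the inequality \<open>a\<^sub>i\<^sub>J < \<pi>\<^sub>J R\<^sub>i\<close> is equivalent to
  \<open>a\<^sub>i\<^sub>J / R\<^sub>i < \<pi>\<^sub>J\<close>. For fixed \<open>J\<close>, the latter holds for every \<open>i\<close> with \<open>(i,\<dots>,i) \<noteq> J\<close>
  exactly when the maximum of the left-hand sides over these finitely many \<open>i\<close> is less
  than \<open>\<pi>\<^sub>J\<close>. If there is no such \<open>i\<close>, both conditions hold trivially, because the
  maximum is then \<open>-\<infinity>\<close>. The theorem follows by interchanging the quantifiers over \<open>i\<close> and \<open>J\<close>.
\<close>

lemma M_max_less_iff:
  "M_max m A J < ereal c \<longleftrightarrow> (\<forall>i. replicate (m - 1) i \<noteq> J \<longrightarrow> M_entry m A i J < c)"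
proof (cases "{i. replicate (m - 1) i \<noteq> J} = {}")
  case True
  then show ?thesis by (auto simp: M_max_def)
next
  case False
  then show ?thesis by (simp add: M_max_def Let_def Max_less_iff)
qed

lemma M_entry_less_iff:
  assumes "row_sum m A i > 0"
  shows "M_entry m A i J < c \<longleftrightarrow> A (i # J) < c * row_sum m A i"
  using assms by (simp add: M_entry_def pos_divide_less_eq)

theorem proposition2p2:
  fixes m :: nat and A :: "'n::finite tensor" and \<pi> :: "real ^ 'n"
  assumes "m \<ge> 1"
    and "\<And>i. row_sum m A i > 0"
  shows "B_pi_R_tensor m \<pi> A \<longleftrightarrow>
    (\<forall>i. 0 \<le> \<pi> $ i) \<and>
    0 < (\<Sum>J\<in>multi_indices (m - 1). vec_monom \<pi> J) \<and>
    (\<Sum>J\<in>multi_indices (m - 1). vec_monom \<pi> J) \<le> 1 \<and>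
    (\<forall>J\<in>multi_indices (m - 1). ereal (vec_monom \<pi> J) > M_max m A J)"
proof -
  have "(\<forall>i. row_sum m A i > 0 \<and>
          (\<forall>J\<in>multi_indices (m - 1) - {replicate (m - 1) i}.
             vec_monom \<pi> J * row_sum m A i > A (i # J))) \<longleftrightarrow>
        (\<forall>J\<in>multi_indices (m - 1). ereal (vec_monom \<pi> J) > M_max m A J)"
    by (auto simp: M_max_less_iff M_entry_less_iff assms(2)) metis
  then show ?thesis
    unfolding B_pi_R_tensor_def by (simp only:)
qed

end
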